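(* Let $\{F_m\}_{m=1}^\infty\subset Hol(B(\mathcal{X})^n_1)$ be a sequence of free holomorphic functions which is uniformly convergent on any closed operatorial $n$-ball of radius $r\in[0,1)$. Then there is a free holomorphic function $F\in Hol(B(\mathcal{X})^n_1)$ such that $F_m$ converges to $F$ uniformly on any closed operatorial $n$-ball of radius $r\in[0,1)$. Moreover, given $i_1,\ldots,i_k\in\{1,\ldots,n\}$, the sequence $\Big\{\dfrac{\partial^kF_m}{\partial Z_{i_1}\cdots\partial Z_{i_k}}\Big\}_{m=1}^\infty$ is uniformly convergent to $\dfrac{\partial^kF}{\partial Z_{i_1}\cdots\partial Z_{i_k}}$ on any closed operatorial $n$-ball of radius $r\in[0,1)$, where $\dfrac{\partial^k}{\partial Z_{i_1}\cdots\partial Z_{i_k}}$ is the $k$-order Hausdorff derivation.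
   Context: $\mathbb{F}_n^+$ is the unital free semigroup on generators $g_1,\ldots,g_n$ with identity $g_0$; $|\alpha|$ is word length; $X_\alpha:=X_{i_1}\cdots X_{i_k}$ if $\alpha=g_{i_1}\cdots g_{i_k}$, $X_{g_0}:=I$ (similarly $Z_\alpha$ for noncommuting indeterminates). $Hol(B(\mathcal{X})^n_1)$ is the set of formal power series $F=\sum_\alpha a_\alpha Z_\alpha$, $a_\alpha\in\mathbb{C}$, with $\limsup_{k\to\infty}(\sum_{|\alpha|=k}|a_\alpha|^2)^{1/2k}\le1$; then $F(X_1,\ldots,X_n):=\sum_{k=0}^\infty\sum_{|\alpha|=k}a_\alpha X_\alpha$ converges in norm for every Hilbert space $\mathcal{H}$ and every $[X_1,\ldots,X_n]\in B(\mathcal{H})^n$ with $\|\sum_iX_iX_i^*\|<1$. Uniform convergence on the closed operatorial $n$-ball of radius $r\in[0,1)$ means uniform convergence (operator norm) of the functions $X\mapsto F_m(X)$ on $[B(\mathcal{H})^n]_r^-:=\{[X_1,\ldots,X_n]\in B(\mathcal{H})^n:\|X_1X_1^*+\cdots+X_nX_n^*\|^{1/2}\le r\}$, where $\mathcal{H}$ is an infinite dimensional Hilbert space. The Hausdorff derivation $\frac{\partial}{\partial Z_i}$ is the linear derivation (product rule $\frac{\partial(fg)}{\partial Z_i}=\frac{\partial f}{\partial Z_i}g+f\frac{\partial g}{\partial Z_i}$) on noncommutative polynomials with $\frac{\partial I}{\partial Z_i}=0$, $\frac{\partial Z_j}{\partial Z_i}=\delta_{ij}I$, extended termwise to power series;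 $\frac{\partial^kF}{\partial Z_{i_1}\cdots\partial Z_{i_k}}:=\frac{\partial}{\partial Z_{i_1}}(\cdots(\frac{\partial F}{\partial Z_{i_k}})\cdots)$. It maps $Hol(B(\mathcal{X})^n_1)$ into itself. *)

theory Defs
  imports "HOL-Analysis.Analysis"
begin

section \<open>Complex Hilbert spaces and their bounded operators\<close>

text \<open>
  A complex Hilbert space is presented on top of the underlying real Hilbert space, whose norm and
  topology it shares. The inner product is linear in the first argument, and its positive
  definiteness is inherited from the real inner product, which is its real part.
\<close>

class chilbert_space = real_inner + banach +
  fixes scaleC :: "complex \<Rightarrow> 'a \<Rightarrow> 'a"  (infixr "*\<^sub>C" 75)
    and cinner :: "'a \<Rightarrow> 'a \<Rightarrow> complex"
  assumes scaleC_add_right: "c *\<^sub>C (x + y) = c *\<^sub>C x + c *\<^sub>C y"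
    and scaleC_add_left: "(c + d) *\<^sub>C x = c *\<^sub>C x + d *\<^sub>C x"
    and scaleC_scaleC: "c *\<^sub>C d *\<^sub>C x = (c * d) *\<^sub>C x"
    and scaleC_of_real: "complex_of_real r *\<^sub>C x = r *\<^sub>R x"
    and cinner_add_left: "cinner (x + y) z = cinner x z + cinner y z"
    and cinner_scaleC_left: "cinner (c *\<^sub>C x) y = c * cinner x y"
    and cinner_commute: "cinner x y = cnj (cinner y x)"
    and inner_eq_Re_cinner: "inner x y = Re (cinner x y)"

lemma module_scaleC: "module (scaleC :: complex \<Rightarrow> 'a::chilbert_space \<Rightarrow> 'a)"
proof
  show "1 *\<^sub>C x = x" for x :: 'a
    using scaleC_of_real[of 1 x] by simp
qed (simp_all add: scaleC_add_right scaleC_add_left scaleC_scaleC)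

lemma cinner_scaleC_right: "cinner x (c *\<^sub>C y) = cnj c * cinner x y"
  by (metis cinner_commute cinner_scaleC_left complex_cnj_mult)

lemma norm_scaleC: "norm (c *\<^sub>C x) = cmod c * norm (x :: 'a :: chilbert_space)"
proof -
  have "cinner (c *\<^sub>C x) (c *\<^sub>C x) = complex_of_real ((cmod c)\<^sup>2) * cinner x x"
    unfolding complex_norm_square by (simp add: cinner_scaleC_left cinner_scaleC_right)
  hence "(norm (c *\<^sub>C x))\<^sup>2 = (cmod c * norm x)\<^sup>2"
    by (simp add: power2_norm_eq_inner power_mult_distrib inner_eq_Re_cinner)
  thus ?thesis by simp
qed

text \<open>
  The set \<open>B(H)\<close>. For complex linear maps the norm of type \<^typ>\<open>'h \<Rightarrow>\<^sub>L 'h\<close> is the usual operator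
  norm, because the real and the complex structure of \<open>H\<close> have the same norm.
\<close>

definition bounded_operators :: "('h::chilbert_space \<Rightarrow>\<^sub>L 'h) set" where
  "bounded_operators = {T. \<forall>c x. blinfun_apply T (c *\<^sub>C x) = c *\<^sub>C T x}"

lift_definition scaleC_blinfun ::
  "complex \<Rightarrow> ('h::chilbert_space \<Rightarrow>\<^sub>L 'h) \<Rightarrow> ('h \<Rightarrow>\<^sub>L 'h)" is "\<lambda>c T x. c *\<^sub>C T x"
proof -
  fix c and T :: "'h \<Rightarrow> 'h"
  assume T: "bounded_linear T"
  have comm: "c *\<^sub>C r *\<^sub>R x = r *\<^sub>R c *\<^sub>C x" for r and x :: 'h
    by (simp add: scaleC_of_real[symmetric] scaleC_scaleC mult.commute)
  have "bounded_linear (\<lambda>x::'h. c *\<^sub>C x)"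
    by (rule bounded_linear_intro[where K = "cmod c"])
      (simp_all add: scaleC_add_right comm norm_scaleC mult.commute)
  from bounded_linear_compose[OF this T] show "bounded_linear (\<lambda>x. c *\<^sub>C T x)" .
qed

text \<open>Existence and uniqueness for \<open>T\<close> in \<open>B(H)\<close> are part of the proof of \<open>cinner_cadjoint\<close> below.\<close>

definition cadjoint :: "('h::chilbert_space \<Rightarrow>\<^sub>L 'h) \<Rightarrow> ('h \<Rightarrow>\<^sub>L 'h)" where
  "cadjoint T = (THE S. \<forall>x y. cinner (T x) y = cinner x (blinfun_apply S y))"

lemma riesz_representation:
  fixes f :: "'a::{real_inner,banach} \<Rightarrow> real"
  assumes "bounded_linear f"
  shows "\<exists>z. \<forall>x. f x = x \<bullet> z"
proof -
  interpret f: bounded_linear f by fact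
  define g where "g x = x \<bullet> x - 2 * f x" for x
  obtain K where K: "\<And>x. norm (f x) \<le> norm x * K"
    using f.bounded by blast
  have lower: "- K\<^sup>2 \<le> g x" for x
  proof -
    have "0 \<le> (norm x - K)\<^sup>2" by simp
    moreover have "f x \<le> norm x * K" using K[of x] by simp
    ultimately show ?thesis
      by (simp add: g_def power2_diff power2_norm_eq_inner)
  qed
  define m where "m = (INF x. g x)"
  have bdd: "bdd_below (range g)" by (rule bdd_belowI2[OF lower])
  have m_le: "m \<le> g x" for x
    unfolding m_def by (rule cINF_lower[OF bdd]) simp
  have "\<exists>x. g x < m + inverse (real (Suc n))" for n
  proof -
    have "(INF x. g x) < m + inverse (real (Suc n))" unfolding m_def by simp
    thus ?thesis by (subst (asm) cINF_less_iff[OF _ bdd]) auto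
  qed
  then obtain X where X: "\<And>n. g (X n) < m + inverse (real (Suc n))" by metis
  have par: "(norm (x - y))\<^sup>2 = 2 * (g x + g y - 2 * g ((1/2) *\<^sub>R (x + y)))" for x y
    by (simp add: g_def power2_norm_eq_inner f.add f.scaleR inner_commute algebra_simps)
  have "Cauchy X"
  proof (rule metric_CauchyI)
    fix e :: real assume e: "0 < e"
    then obtain N where N: "inverse (real (Suc N)) < e\<^sup>2 / 4"
      using reals_Archimedean[of "e\<^sup>2 / 4"] by auto
    have small: "g (X n) < m + e\<^sup>2 / 4" if "n \<ge> N" for n
    proof -
      have "inverse (real (Suc n)) \<le> inverse (real (Suc N))" using that by simp
      with X[of n] N show ?thesis by linarith
    qed
    have arith: "2 * (u + v - 2 * w) < d" if "u < m + d / 4" "v < m + d / 4" "m \<le> w"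
      for u v w d :: real
      using that by (simp add: field_simps)
    have "dist (X i) (X j) < e" if "i \<ge> N" "j \<ge> N" for i j
    proof -
      have "(norm (X i - X j))\<^sup>2 < e\<^sup>2"
        unfolding par
        by (rule arith[OF small[OF that(1)] small[OF that(2)] m_le])
      thus ?thesis using e by (simp add: dist_norm power2_less_imp_less)
    qed
    thus "\<exists>M. \<forall>i\<ge>M. \<forall>j\<ge>M. dist (X i) (X j) < e" by blast
  qed
  then obtain z where z: "X \<longlonglongrightarrow> z" using Cauchy_convergent convergent_def by blast
  have "(\<lambda>n. g (X n)) \<longlonglongrightarrow> g z"
    unfolding g_def by (intro tendsto_intros z f.tendsto)
  moreover have "(\<lambda>n. m + inverse (real (Suc n))) \<longlonglongrightarrow> m + 0"
    by (intro tendsto_intros LIMSEQ_inverse_real_of_nat)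
  ultimately have gz: "g z \<le> m + 0"
    by (rule LIMSEQ_le) (use X less_imp_le in blast)
  have "f x = x \<bullet> z" for x
  proof (cases "x = 0")
    case False
    define d t where "d = f x - x \<bullet> z" and "t = d / (x \<bullet> x)"
    have pos: "x \<bullet> x > 0" using False by simp
    have "g z \<le> g (z + t *\<^sub>R x)" using gz m_le order_trans by fastforce
    hence "0 \<le> t * t * (x \<bullet> x) - 2 * t * d"
      by (simp add: g_def d_def f.add f.scaleR inner_commute algebra_simps)
    also have "\<dots> = - (d * d / (x \<bullet> x))" using pos by (simp add: t_def field_simps)
    finally have "d * d / (x \<bullet> x) \<le> 0" by simp
    with pos have "d * d \<le> 0" by (auto simp: divide_le_0_iff not_le[symmetric])
    hence "d = 0" by (metis mult_eq_0_iff not_square_less_zero order.antisym not_le)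
    thus ?thesis by (simp add: d_def)
  qed simp
  thus ?thesis by blast
qed

lemma cinner_cadjoint:
  fixes T :: "'h::chilbert_space \<Rightarrow>\<^sub>L 'h"
  assumes "T \<in> bounded_operators"
  shows "cinner (T x) y = cinner x (cadjoint T y)"
proof -
  have T: "T (c *\<^sub>C x) = c *\<^sub>C T x" for c x
    using assms by (simp add: bounded_operators_def)
  have "\<exists>z. \<forall>x. T x \<bullet> y = x \<bullet> z" for y
    by (rule riesz_representation) (intro bounded_linear_intros)
  then obtain S where S: "\<And>x y. T x \<bullet> y = x \<bullet> S y" by metis
  have "bounded_linear S"
  proof (rule bounded_linear_intro[where K = "norm T"])
    have "z \<bullet> S (x + y) = z \<bullet> (S x + S y)" for x y z
      by (simp add: S[symmetric] inner_add_right)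
    thus "S (x + y) = S x + S y" for x y by (metis vector_eq_ldot)
    have "z \<bullet> S (r *\<^sub>R x) = z \<bullet> (r *\<^sub>R S x)" for r x z
      by (simp add: S[symmetric])
    thus "S (r *\<^sub>R x) = r *\<^sub>R S x" for r x by (metis vector_eq_ldot)
    show "norm (S x) \<le> norm x * norm T" for x
    proof (cases "S x = 0")
      case False
      have "norm (S x) * norm (S x) = T (S x) \<bullet> x"
        by (simp add: S power2_norm_eq_inner flip: power2_eq_square)
      also have "\<dots> \<le> norm (T (S x)) * norm x" by (rule norm_cauchy_schwarz)
      also have "\<dots> \<le> norm T * norm (S x) * norm x"
        by (intro mult_right_mono norm_blinfun norm_ge_zero)
      finally have "norm (S x) * norm (S x) \<le> norm (S x) * (norm x * norm T)"
        by (simp add: mult_ac)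
      thus ?thesis using False by simp
    qed simp
  qed
  then obtain S' where S': "\<And>x. blinfun_apply S' x = S x"
    by (metis bounded_linear_Blinfun_apply)
  have cS: "cinner (T x) y = cinner x (S' y)" for x y
  proof (rule complex_eqI)
    show "Re (cinner (T x) y) = Re (cinner x (S' y))" for x
      by (simp add: inner_eq_Re_cinner[symmetric] S S')
    from this[of "\<i> *\<^sub>C x"] show "Im (cinner (T x) y) = Im (cinner x (S' y))"
      by (simp add: T cinner_scaleC_left)
  qed
  have "cadjoint T = S'"
    unfolding cadjoint_def
  proof (rule the_equality)
    fix R :: "'h \<Rightarrow>\<^sub>L 'h" assume R: "\<forall>x y. cinner (T x) y = cinner x (R y)"
    have "x \<bullet> R y = x \<bullet> S' y" for x y
      using R cS by (simp add: inner_eq_Re_cinner)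
    thus "R = S'" by (intro blinfun_eqI) (metis vector_eq_ldot)
  qed (use cS in blast)
  with cS show ?thesis by simp
qed

section \<open>Free holomorphic functions\<close>

text \<open>
  The generators are indexed by a finite type \<^typ>\<open>'n\<close>, so that \<^typ>\<open>'n list\<close> is the free monoid on
  \<open>CARD('n)\<close> generators with \<^term>\<open>[]\<close> in the role of the identity, and a formal power series in
  noncommuting indeterminates is its family of coefficients.
\<close>

type_synonym 'n power_series = "'n list \<Rightarrow> complex"

definition free_holomorphic :: "'n::finite power_series set" where
  "free_holomorphic =
    {a. limsup (\<lambda>k. ereal ((\<Sum>\<alpha> | length \<alpha> = k. (cmod (a \<alpha>))\<^sup>2) powr (1 / (2 * real k)))) \<le> 1}"

primrec word_eval :: "('n \<Rightarrow> ('h::chilbert_space \<Rightarrow>\<^sub>L 'h)) \<Rightarrow> 'n list \<Rightarrow> ('h \<Rightarrow>\<^sub>L 'h)" where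
  "word_eval X [] = id_blinfun"
| "word_eval X (i # \<alpha>) = X i o\<^sub>L word_eval X \<alpha>"

definition eval_series ::
    "'n::finite power_series \<Rightarrow> ('n \<Rightarrow> ('h::chilbert_space \<Rightarrow>\<^sub>L 'h)) \<Rightarrow> ('h \<Rightarrow>\<^sub>L 'h)" where
  "eval_series a X = (\<Sum>k. \<Sum>\<alpha> | length \<alpha> = k. scaleC_blinfun (a \<alpha>) (word_eval X \<alpha>))"

definition operator_ball :: "real \<Rightarrow> ('n::finite \<Rightarrow> ('h::chilbert_space \<Rightarrow>\<^sub>L 'h)) set" where
  "operator_ball r =
    {X. (\<forall>i. X i \<in> bounded_operators) \<and> sqrt (norm (\<Sum>i\<in>UNIV. X i o\<^sub>L cadjoint (X i))) \<le> r}"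

section \<open>Hausdorff derivations\<close>

definition monomial :: "'n list \<Rightarrow> 'n power_series" where
  "monomial \<alpha> = (\<lambda>\<beta>. if \<beta> = \<alpha> then 1 else 0)"

definition series_mult :: "'n power_series \<Rightarrow> 'n power_series \<Rightarrow> 'n power_series" where
  "series_mult f g = (\<lambda>\<beta>. \<Sum>k\<le>length \<beta>. f (take k \<beta>) * g (drop k \<beta>))"

text \<open>The recursion is the product rule applied to \<open>Z\<^sub>j Z\<^sub>\<alpha>\<close>.\<close>

primrec word_deriv :: "'n \<Rightarrow> 'n list \<Rightarrow> 'n power_series" where
  "word_deriv i [] = (\<lambda>\<beta>. 0)"
| "word_deriv i (j # \<alpha>) =
    (\<lambda>\<beta>. (if j = i then monomial \<alpha> \<beta> else 0) + series_mult (monomial [j]) (word_deriv i \<alpha>) \<beta>)"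

text \<open>
  The termwise extension: the coefficient at \<open>\<beta>\<close> of the formal sum of all
  \<open>a \<alpha> \<partial>Z\<^sub>\<alpha> / \<partial>Z\<^sub>i\<close>. Only words \<open>\<alpha>\<close> with one letter more than \<open>\<beta>\<close> contribute
  (see \<open>word_deriv_eq_0\<close> below).
\<close>

definition hausdorff_deriv :: "'n::finite \<Rightarrow> 'n power_series \<Rightarrow> 'n power_series" where
  "hausdorff_deriv i a = (\<lambda>\<beta>. \<Sum>\<alpha> | length \<alpha> = Suc (length \<beta>). a \<alpha> * word_deriv i \<alpha> \<beta>)"

text \<open>For \<open>is = [i\<^sub>1, \<dots>, i\<^sub>k]\<close> the derivation with respect to \<open>Z\<close> of index \<open>i\<^sub>k\<close> is applied first.\<close>

definition hausdorff_derivs :: "'n::finite list \<Rightarrow> 'n power_series \<Rightarrow> 'n power_series" where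
  "hausdorff_derivs is a = foldr hausdorff_deriv is a"

lemma series_mult_monomial_single:
  "series_mult (monomial [j]) f \<beta> = (case \<beta> of [] \<Rightarrow> 0 | l # \<gamma> \<Rightarrow> if l = j then f \<gamma> else 0)"
proof (cases \<beta>)
  case (Cons l \<gamma>)
  have eq: "take k (l # \<gamma>) = [j] \<longleftrightarrow> k = 1 \<and> l = j" if "k \<le> Suc (length \<gamma>)" for k
    using that by (cases k) (auto simp: take_eq_Nil)
  have "series_mult (monomial [j]) f \<beta> =
      (\<Sum>k\<le>Suc (length \<gamma>). if k = 1 then (if l = j then f \<gamma> else 0) else 0)"
    unfolding series_mult_def Cons monomial_def
    by (intro sum.cong) (auto simp: eq)
  also have "\<dots> = (if l = j then f \<gamma> else 0)"
    by (subst sum.delta) auto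
  finally show ?thesis using Cons by simp
qed (simp add: series_mult_def monomial_def)

lemma word_deriv_eq:
  "word_deriv i \<alpha> \<beta> = (\<Sum>p\<le>length \<beta>. monomial (take p \<beta> @ i # drop p \<beta>) \<alpha>)"
proof (induction \<alpha> arbitrary: \<beta>)
  case Nil
  show ?case by (simp add: monomial_def)
next
  case (Cons j \<alpha>)
  show ?case
  proof (cases \<beta>)
    case Nil
    thus ?thesis by (simp add: series_mult_monomial_single) (simp add: monomial_def eq_commute)
  next
    case (Cons l \<gamma>)
    have "(\<Sum>p\<le>length \<beta>. monomial (take p \<beta> @ i # drop p \<beta>) (j # \<alpha>)) =
        monomial (i # \<beta>) (j # \<alpha>) +
        (\<Sum>p\<le>length \<gamma>. monomial (l # take p \<gamma> @ i # drop p \<gamma>) (j # \<alpha>))"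
      by (simp add: Cons sum.atMost_Suc_shift del: sum.atMost_Suc)
    also have "(\<Sum>p\<le>length \<gamma>. monomial (l # take p \<gamma> @ i # drop p \<gamma>) (j # \<alpha>)) =
        (if l = j then word_deriv i \<alpha> \<gamma> else 0)"
      unfolding Cons.IH by (auto simp: monomial_def)
    finally show ?thesis
      by (simp add: Cons series_mult_monomial_single) (auto simp: monomial_def)
  qed
qed

lemma word_deriv_eq_0: "length \<alpha> \<noteq> Suc (length \<beta>) \<Longrightarrow> word_deriv i \<alpha> \<beta> = 0"
  unfolding word_deriv_eq by (intro sum.neutral) (auto simp: monomial_def)

lemma hausdorff_deriv_eq:
  "hausdorff_deriv i a \<beta> = (\<Sum>p\<le>length \<beta>. a (take p \<beta> @ i # drop p \<beta>))"
proof -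
  have fin: "finite {\<alpha> :: 'a list. length \<alpha> = k}" for k
    using finite_lists_length_eq[of "UNIV :: 'a set" k] by simp
  have "hausdorff_deriv i a \<beta> = (\<Sum>p\<le>length \<beta>. \<Sum>\<alpha> | length \<alpha> = Suc (length \<beta>).
      if \<alpha> = take p \<beta> @ i # drop p \<beta> then a \<alpha> else 0)"
    unfolding hausdorff_deriv_def word_deriv_eq sum_distrib_left
    by (subst sum.swap, intro sum.cong refl) (auto simp: monomial_def)
  also have "\<dots> = (\<Sum>p\<le>length \<beta>. a (take p \<beta> @ i # drop p \<beta>))"
    by (intro sum.cong refl) (auto simp: fin)
  finally show ?thesis .
qed

lemma hausdorff_deriv_monomial: "hausdorff_deriv i (monomial \<alpha>) = word_deriv i \<alpha>"
  by (rule ext) (simp add: hausdorff_deriv_eq word_deriv_eq monomial_def eq_commute)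

text \<open>
  The properties below characterize the derivation on polynomials; the product rule holds for
  arbitrary power series.
\<close>

lemma hausdorff_deriv_one: "hausdorff_deriv i (monomial []) = (\<lambda>\<beta>. 0)"
  by (simp add: hausdorff_deriv_monomial)

lemma hausdorff_deriv_var:
  "hausdorff_deriv i (monomial [j]) = (if i = j then monomial [] else (\<lambda>\<beta>. 0))"
  by (auto simp: hausdorff_deriv_monomial series_mult_def fun_eq_iff)

lemma hausdorff_deriv_linear:
  "hausdorff_deriv i (\<lambda>\<alpha>. c * a \<alpha> + d * b \<alpha>) =
    (\<lambda>\<beta>. c * hausdorff_deriv i a \<beta> + d * hausdorff_deriv i b \<beta>)"
  by (rule ext) (simp add: hausdorff_deriv_eq sum.distrib sum_distrib_left)

lemma hausdorff_deriv_mult: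
  "hausdorff_deriv i (series_mult a b) =
    (\<lambda>\<beta>. series_mult (hausdorff_deriv i a) b \<beta> + series_mult a (hausdorff_deriv i b) \<beta>)"
proof
  fix \<beta> :: "'a list"
  let ?n = "length \<beta>"
  let ?w = "\<lambda>p. take p \<beta> @ i # drop p \<beta>"
  let ?L = "\<lambda>p k. a (take p \<beta> @ i # drop p (take k \<beta>)) * b (drop k \<beta>)"
  let ?R = "\<lambda>p k. a (take k \<beta>) * b (drop k (take p \<beta>) @ i # drop p \<beta>)"
  have split: "(\<Sum>k\<le>Suc ?n. a (take k (?w p)) * b (drop k (?w p))) =
      (\<Sum>k=p..?n. ?L p k) + (\<Sum>k\<le>p. ?R p k)" if "p \<le> ?n" for p
  proof -
    have "{..Suc ?n} = {..p} \<union> {Suc p..Suc ?n}" using that by auto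
    hence "(\<Sum>k\<le>Suc ?n. a (take k (?w p)) * b (drop k (?w p))) =
        (\<Sum>k\<le>p. a (take k (?w p)) * b (drop k (?w p))) +
        (\<Sum>k=Suc p..Suc ?n. a (take k (?w p)) * b (drop k (?w p)))"
      by (simp only:) (rule sum.union_disjoint, auto)
    also have "(\<Sum>k=Suc p..Suc ?n. a (take k (?w p)) * b (drop k (?w p))) =
        (\<Sum>k=p..?n. a (take (Suc k) (?w p)) * b (drop (Suc k) (?w p)))"
      by (rule sum.shift_bounds_cl_Suc_ivl)
    also have "\<dots> = (\<Sum>k=p..?n. ?L p k)"
      using that by (intro sum.cong refl) (auto simp: Suc_diff_le take_Cons drop_Cons drop_take)
    also have "(\<Sum>k\<le>p. a (take k (?w p)) * b (drop k (?w p))) = (\<Sum>k\<le>p. ?R p k)"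
      using that by (intro sum.cong refl) auto
    finally show ?thesis by simp
  qed
  have "hausdorff_deriv i (series_mult a b) \<beta> =
      (\<Sum>p\<le>?n. \<Sum>k=p..?n. ?L p k) + (\<Sum>p\<le>?n. \<Sum>k\<le>p. ?R p k)"
  proof -
    have "hausdorff_deriv i (series_mult a b) \<beta> =
        (\<Sum>p\<le>?n. \<Sum>k\<le>Suc ?n. a (take k (?w p)) * b (drop k (?w p)))"
      unfolding hausdorff_deriv_eq series_mult_def by (intro sum.cong refl) auto
    also have "\<dots> = (\<Sum>p\<le>?n. (\<Sum>k=p..?n. ?L p k) + (\<Sum>k\<le>p. ?R p k))"
      by (intro sum.cong refl split) simp
    finally show ?thesis by (simp only: sum.distrib)
  qed
  also have "(\<Sum>p\<le>?n. \<Sum>k=p..?n. ?L p k) = (\<Sum>k\<le>?n. \<Sum>p\<le>k. ?L p k)"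
    unfolding sum.Sigma[OF finite_atMost ballI[OF finite_atLeastAtMost]]
      sum.Sigma[OF finite_atMost ballI[OF finite_atMost]]
    by (rule sum.reindex_bij_witness[of _ "\<lambda>(k, p). (p, k)" "\<lambda>(p, k). (k, p)"]) auto
  also have "\<dots> = series_mult (hausdorff_deriv i a) b \<beta>"
    unfolding series_mult_def hausdorff_deriv_eq sum_distrib_right
    by (intro sum.cong) (auto simp: min.absorb1 min.absorb2)
  also have "(\<Sum>p\<le>?n. \<Sum>k\<le>p. ?R p k) = (\<Sum>k\<le>?n. \<Sum>p=k..?n. ?R p k)"
    unfolding sum.Sigma[OF finite_atMost ballI[OF finite_atLeastAtMost]]
      sum.Sigma[OF finite_atMost ballI[OF finite_atMost]]
    by (rule sum.reindex_bij_witness[of _ "\<lambda>(k, p). (p, k)" "\<lambda>(p, k). (k, p)"]) auto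
  also have "\<dots> = series_mult a (hausdorff_deriv i b) \<beta>"
    unfolding series_mult_def hausdorff_deriv_eq sum_distrib_left
  proof (rule sum.cong[OF refl])
    fix k assume "k \<in> {..?n}"
    thus "(\<Sum>p=k..?n. ?R p k) = (\<Sum>p\<le>length (drop k \<beta>).
        a (take k \<beta>) * b (take p (drop k \<beta>) @ i # drop p (drop k \<beta>)))"
      by (intro sum.reindex_bij_witness[of _ "\<lambda>p. p + k" "\<lambda>p. p - k"]) (auto simp: drop_take)
  qed
  finally show "hausdorff_deriv i (series_mult a b) \<beta> =
      series_mult (hausdorff_deriv i a) b \<beta> + series_mult a (hausdorff_deriv i b) \<beta>" .
qed

end

theory Submission
  imports Defs
begin

text \<open>
  Uniform convergence on all balls is equivalent to a statement about coefficients: for every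
  \<open>r < 1\<close>, the numbers \<open>r\<^sup>k (\<Sum>\<^sub>|\<^sub>\<alpha>\<^sub>|\<^sub>=\<^sub>k |a\<^sub>\<alpha>|\<^sup>2)\<^sup>1\<^sup>/\<^sup>2\<close> of the differences tend to \<open>0\<close> uniformly in
  \<open>k\<close>. In one direction, an infinite-dimensional \<open>H\<close> contains copies of the creation operators of
  the Fock space truncated at words of length \<open>N\<close>; evaluating a series at \<open>r\<close> times these operators
  and applying it to the vacuum vector recovers the vector of coefficients \<open>r\<^sup>|\<^sup>\<alpha>\<^sup>| a\<^sub>\<alpha>\<close>, so a bound on
  the ball gives a Cauchy estimate. In the other direction, every \<open>X\<close> in the ball satisfies
  \<open>\<parallel>\<Sum>\<^sub>|\<^sub>\<alpha>\<^sub>|\<^sub>=\<^sub>k a\<^sub>\<alpha> X\<^sub>\<alpha>\<parallel> \<le> r\<^sup>k (\<Sum>\<^sub>|\<^sub>\<alpha>\<^sub>|\<^sub>=\<^sub>k |a\<^sub>\<alpha>|\<^sup>2)\<^sup>1\<^sup>/\<^sup>2\<close>. The coefficient condition is complete, and it is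
  stable under the Hausdorff derivations, which take coefficients of degree \<open>k + 1\<close> to degree \<open>k\<close>
  with norm at most \<open>k + 1\<close>; this factor is absorbed by increasing \<open>r\<close>.
\<close>

interpretation complex_module: module scaleC
  by (rule module_scaleC)

section \<open>Orthonormal families\<close>

lemma cinner_add_right: "cinner x (y + z) = cinner x y + cinner x z"
  by (metis cinner_commute cinner_add_left complex_cnj_add)

lemma cinner_zero_left [simp]: "cinner 0 x = 0"
  using cinner_add_left[of 0 0 x] by simp

lemma cinner_zero_right [simp]: "cinner x 0 = 0"
  using cinner_add_right[of x 0 0] by simp

lemma cinner_diff_left: "cinner (x - y) z = cinner x z - cinner y z"
  using cinner_add_left[of "x - y" y z] by simp

lemma cinner_sum_left: "cinner (sum f A) y = (\<Sum>a\<in>A. cinner (f a) y)"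
  by (induction A rule: infinite_finite_induct) (simp_all add: cinner_add_left)

lemma cinner_sum_right: "cinner x (sum f A) = (\<Sum>a\<in>A. cinner x (f a))"
  by (induction A rule: infinite_finite_induct) (simp_all add: cinner_add_right)

lemma cinner_self: "cinner x x = complex_of_real ((norm x)\<^sup>2)"
proof (rule complex_eqI)
  show "Re (cinner x x) = Re (complex_of_real ((norm x)\<^sup>2))"
    by (simp add: inner_eq_Re_cinner[symmetric] power2_norm_eq_inner)
  have "Im (cinner x x) = - Im (cinner x x)"
    by (metis cinner_commute cnj.simps(2))
  thus "Im (cinner x x) = Im (complex_of_real ((norm x)\<^sup>2))" by simp
qed

text \<open>Families are indexed so that words can label vectors; the identity family covers sets of
  vectors.\<close>

definition orthonormal_on :: "('a \<Rightarrow> 'h::chilbert_space) \<Rightarrow> 'a set \<Rightarrow> bool" where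
  "orthonormal_on e A \<longleftrightarrow> (\<forall>a\<in>A. \<forall>b\<in>A. cinner (e a) (e b) = (if a = b then 1 else 0))"

lemma orthonormal_onD:
  "orthonormal_on e A \<Longrightarrow> a \<in> A \<Longrightarrow> b \<in> A \<Longrightarrow> cinner (e a) (e b) = (if a = b then 1 else 0)"
  by (simp add: orthonormal_on_def)

lemma cinner_orthonormal_sum_left:
  assumes "finite A" "orthonormal_on e A" "b \<in> A"
  shows "cinner (\<Sum>a\<in>A. c a *\<^sub>C e a) (e b) = c b"
proof -
  have "cinner (\<Sum>a\<in>A. c a *\<^sub>C e a) (e b) = (\<Sum>a\<in>A. if a = b then c a else 0)"
    unfolding cinner_sum_left
    by (intro sum.cong refl) (auto simp: cinner_scaleC_left orthonormal_onD[OF assms(2) _ assms(3)])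
  thus ?thesis using assms by simp
qed

lemma norm_orthonormal_sum:
  assumes "finite A" "orthonormal_on e A"
  shows "norm (\<Sum>a\<in>A. c a *\<^sub>C e a) = L2_set (\<lambda>a. cmod (c a)) A"
proof -
  let ?s = "\<Sum>a\<in>A. c a *\<^sub>C e a"
  have "complex_of_real ((norm ?s)\<^sup>2) = (\<Sum>b\<in>A. cnj (c b) * cinner ?s (e b))"
    unfolding cinner_self[symmetric] by (subst cinner_sum_right) (simp add: cinner_scaleC_right)
  also have "\<dots> = (\<Sum>b\<in>A. cnj (c b) * c b)"
    by (intro sum.cong refl) (simp add: cinner_orthonormal_sum_left[OF assms])
  also have "\<dots> = complex_of_real (\<Sum>b\<in>A. (cmod (c b))\<^sup>2)"
    by (simp only: of_real_sum complex_norm_square mult.commute)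
  finally have "(norm ?s)\<^sup>2 = (\<Sum>b\<in>A. (cmod (c b))\<^sup>2)"
    by (simp only: of_real_eq_iff)
  thus ?thesis
    by (simp add: L2_set_def real_sqrt_unique)
qed

text \<open>The sum \<open>?s\<close> is the orthogonal projection of \<open>y\<close> onto the span
  of the family: pairing it with \<open>?s\<close> or with \<open>y\<close> gives the same value,
  and Cauchy-Schwarz then lets one factor \<open>norm ?s\<close> cancel.\<close>

lemma bessel:
  assumes "finite A" "orthonormal_on e A"
  shows "norm (\<Sum>a\<in>A. cinner y (e a) *\<^sub>C e a) \<le> norm y"
proof -
  let ?s = "\<Sum>a\<in>A. cinner y (e a) *\<^sub>C e a"
  have "cinner ?s ?s = (\<Sum>a\<in>A. cinner ?s (cinner y (e a) *\<^sub>C e a))"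
    by (rule cinner_sum_right)
  also have "\<dots> = (\<Sum>a\<in>A. cinner y (cinner y (e a) *\<^sub>C e a))"
    by (intro sum.cong refl)
      (simp add: cinner_scaleC_right cinner_orthonormal_sum_left[OF assms])
  also have "\<dots> = cinner y ?s"
    by (rule cinner_sum_right[symmetric])
  finally have "cinner ?s ?s = cinner y ?s" .
  hence "(norm ?s)\<^sup>2 = y \<bullet> ?s"
    by (simp add: inner_eq_Re_cinner power2_norm_eq_inner)
  also have "\<dots> \<le> norm y * norm ?s" by (rule norm_cauchy_schwarz)
  finally show ?thesis
    by (cases "?s = 0") (simp_all add: power2_eq_square del: sum_eq_0_iff)
qed

text \<open>Gram-Schmidt, one vector at a time: a finite set never spans, so some \<open>x\<close>
  lies outside the span reached so far, and normalizing \<open>x\<close> minus its projection gives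
  the next vector.\<close>

lemma orthonormal_set_exists:
  assumes infinite_dim: "\<nexists>B :: 'h::chilbert_space set. finite B \<and> module.span scaleC B = UNIV"
  shows "\<exists>B :: 'h::chilbert_space set. finite B \<and> card B = n \<and> orthonormal_on (\<lambda>b. b) B"
proof (induction n)
  case 0
  show ?case by (intro exI[of _ "{}"]) (simp add: orthonormal_on_def)
next
  case (Suc n)
  then obtain B :: "'h set" where B: "finite B" "card B = n" "orthonormal_on (\<lambda>b. b) B" by blast
  from infinite_dim B(1) obtain x where x: "x \<notin> complex_module.span B" by blast
  let ?p = "\<Sum>b\<in>B. cinner x b *\<^sub>C b"
  define y where "y = x - ?p"
  have "?p \<in> complex_module.span B"
    by (intro complex_module.span_sum complex_module.span_scale complex_module.span_base)
  with x have "y \<noteq> 0" by (auto simp: y_def)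
  have yB: "cinner y b = 0" if "b \<in> B" for b
    using cinner_orthonormal_sum_left[OF B(1,3) that, of "cinner x"]
    by (simp add: y_def cinner_diff_left)
  define z where "z = complex_of_real (inverse (norm y)) *\<^sub>C y"
  have zB: "cinner z b = 0" "cinner b z = 0" if "b \<in> B" for b
    using yB[OF that] cinner_commute[of b y]
    by (simp_all add: z_def cinner_scaleC_left cinner_scaleC_right)
  have zz: "cinner z z = 1"
    using \<open>y \<noteq> 0\<close> unfolding cinner_self by (simp add: z_def norm_scaleC norm_inverse)
  \<comment> \<open>A member of \<open>B\<close> is orthogonal to \<open>z\<close>, while
    \<open>cinner z z = 1\<close>; so the cardinality really grows by one.\<close>
  have "z \<notin> B" using zB zz by force
  moreover have "orthonormal_on (\<lambda>b. b) (insert z B)"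
    using B(3) zB zz \<open>z \<notin> B\<close> by (auto simp: orthonormal_on_def)
  ultimately show ?case
    using B by (intro exI[of _ "insert z B"]) simp
qed

lemma orthonormal_family_exists:
  assumes infinite_dim: "\<nexists>B :: 'h::chilbert_space set. finite B \<and> module.span scaleC B = UNIV"
    and "finite A"
  obtains e :: "'a \<Rightarrow> 'h::chilbert_space" where "orthonormal_on e A"
proof -
  obtain B :: "'h set" where B: "finite B" "card B = card A" "orthonormal_on (\<lambda>b. b) B"
    using orthonormal_set_exists[OF infinite_dim] by blast
  then obtain e where "bij_betw e A B"
    using finite_same_card_bij[OF \<open>finite A\<close>] by metis
  hence "orthonormal_on e A"
    using B(3) by (auto simp: orthonormal_on_def bij_betw_def inj_on_eq_iff)
  thus thesis by (rule that)
qed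

section \<open>Operators\<close>

lemma scaleC_blinfun_apply [simp]: "blinfun_apply (scaleC_blinfun c T) x = c *\<^sub>C T x"
  by transfer simp

text \<open>The real Cauchy-Schwarz inequality controls the real part, and the imaginary part after
  multiplying \<open>x\<close> by the imaginary unit. The crude factor 2 suffices for the
  boundedness of \<open>rank_one\<close>.\<close>

lemma cmod_cinner_le: "cmod (cinner x y) \<le> 2 * (norm x * norm y)"
proof -
  have Re: "\<bar>Re (cinner u y)\<bar> \<le> norm u * norm y" for u
    unfolding inner_eq_Re_cinner[symmetric] by (rule Cauchy_Schwarz_ineq2)
  have "\<bar>Im (cinner x y)\<bar> \<le> norm x * norm y"
    using Re[of "\<i> *\<^sub>C x"] by (simp add: cinner_scaleC_left norm_scaleC)
  with Re[of x] cmod_le[of "cinner x y"] show ?thesis by linarith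
qed

lift_definition rank_one :: "'h::chilbert_space \<Rightarrow> 'h \<Rightarrow> 'h \<Rightarrow>\<^sub>L 'h" is "\<lambda>u v x. cinner x u *\<^sub>C v"
proof (rule bounded_linear_intro)
  fix u v x y :: 'h and r :: real
  show "cinner (x + y) u *\<^sub>C v = cinner x u *\<^sub>C v + cinner y u *\<^sub>C v"
    by (simp add: cinner_add_left scaleC_add_left)
  show "cinner (r *\<^sub>R x) u *\<^sub>C v = r *\<^sub>R (cinner x u *\<^sub>C v)"
    by (simp add: scaleC_of_real[symmetric] cinner_scaleC_left scaleC_scaleC)
  have "norm (cinner x u *\<^sub>C v) \<le> 2 * (norm x * norm u) * norm v"
    unfolding norm_scaleC by (intro mult_right_mono cmod_cinner_le) simp
  thus "norm (cinner x u *\<^sub>C v) \<le> norm x * (2 * norm u * norm v)"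
    by (simp add: mult_ac)
qed

lemma rank_one_apply [simp]: "blinfun_apply (rank_one u v) x = cinner x u *\<^sub>C v"
  by transfer simp

lemma cadjoint_eqI:
  assumes "\<And>x y. cinner (blinfun_apply T x) y = cinner x (blinfun_apply S y)"
  shows "cadjoint T = S"
  unfolding cadjoint_def
proof (rule the_equality)
  fix R assume "\<forall>x y. cinner (T x) y = cinner x (blinfun_apply R y)"
  hence "x \<bullet> R y = x \<bullet> S y" for x y
    using assms by (simp add: inner_eq_Re_cinner)
  thus "R = S" by (intro blinfun_eqI) (metis vector_eq_ldot)
qed (use assms in blast)

lemma inner_cadjoint:
  assumes "T \<in> bounded_operators"
  shows "blinfun_apply T x \<bullet> y = x \<bullet> cadjoint T y"
  using cinner_cadjoint[OF assms] by (simp add: inner_eq_Re_cinner)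

text \<open>Duality between the row \<open>X\<close> and the column of adjoints:
  \<open>norm ?z\<close> squared is the pairing of the \<open>y i\<close> with the vectors
  \<open>cadjoint (X i) ?z\<close>, and the squared norms of the latter add up to the inner product
  of \<open>?T ?z\<close> with \<open>?z\<close>, at most \<open>r\<^sup>2\<close> times
  \<open>norm ?z\<close> squared.\<close>

lemma row_contraction:
  fixes X :: "'n::finite \<Rightarrow> ('h::chilbert_space \<Rightarrow>\<^sub>L 'h)"
  assumes X: "X \<in> operator_ball r" and r: "0 \<le> r"
  shows "norm (\<Sum>i\<in>UNIV. X i (y i)) \<le> r * L2_set (\<lambda>i. norm (y i)) UNIV"
proof -
  let ?z = "\<Sum>i\<in>UNIV. X i (y i)"
  let ?T = "\<Sum>i\<in>UNIV. X i o\<^sub>L cadjoint (X i)"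
  have B: "X i \<in> bounded_operators" for i using X by (simp add: operator_ball_def)
  have "sqrt (norm ?T) \<le> r" using X by (simp add: operator_ball_def)
  hence T: "norm ?T \<le> r\<^sup>2" by (rule sqrt_le_D)
  have "(\<Sum>i\<in>UNIV. (norm (cadjoint (X i) ?z))\<^sup>2) = ?T ?z \<bullet> ?z"
    by (simp add: power2_norm_eq_inner inner_cadjoint[OF B] blinfun.sum_left inner_sum_left)
  also have "\<dots> \<le> norm (?T ?z) * norm ?z" by (rule norm_cauchy_schwarz)
  also have "\<dots> \<le> norm ?T * norm ?z * norm ?z"
    by (intro mult_right_mono norm_blinfun norm_ge_zero)
  also have "\<dots> \<le> r\<^sup>2 * norm ?z * norm ?z"
    by (intro mult_right_mono T norm_ge_zero)
  finally have adj: "L2_set (\<lambda>i. norm (cadjoint (X i) ?z)) UNIV \<le> r * norm ?z"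
    using r unfolding L2_set_def by (intro real_le_lsqrt) (auto simp: power2_eq_square mult_ac)
  have "norm ?z * norm ?z = (\<Sum>i\<in>UNIV. y i \<bullet> cadjoint (X i) ?z)"
    unfolding power2_eq_square[symmetric] power2_norm_eq_inner
    by (subst inner_sum_left) (simp add: inner_cadjoint[OF B])
  also have "\<dots> \<le> (\<Sum>i\<in>UNIV. \<bar>norm (y i)\<bar> * \<bar>norm (cadjoint (X i) ?z)\<bar>)"
    by (intro sum_mono) (simp add: norm_cauchy_schwarz)
  also have "\<dots> \<le> L2_set (\<lambda>i. norm (y i)) UNIV * L2_set (\<lambda>i. norm (cadjoint (X i) ?z)) UNIV"
    by (rule L2_set_mult_ineq)
  also have "\<dots> \<le> L2_set (\<lambda>i. norm (y i)) UNIV * (r * norm ?z)"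
    by (intro mult_left_mono adj L2_set_nonneg)
  finally have *: "norm ?z * norm ?z \<le> (r * L2_set (\<lambda>i. norm (y i)) UNIV) * norm ?z"
    by (simp add: mult_ac)
  show ?thesis
  proof (cases "norm ?z = 0")
    case True
    thus ?thesis using r by (simp add: L2_set_nonneg)
  next
    case False
    with * show ?thesis by (simp add: mult_le_cancel_right)
  qed
qed

section \<open>Coefficient norms\<close>

text \<open>For positive \<open>k\<close>, its \<open>k\<close>-th root is the quantity under the
  limsup in \<open>free_holomorphic\<close>.\<close>

definition coeff_norm :: "'n::finite power_series \<Rightarrow> nat \<Rightarrow> real" where
  "coeff_norm a k = L2_set (\<lambda>\<alpha>. cmod (a \<alpha>)) {\<alpha>. length \<alpha> = k}"

definition homogeneous_part ::
    "'n::finite power_series \<Rightarrow> nat \<Rightarrow> ('n \<Rightarrow> ('h::chilbert_space \<Rightarrow>\<^sub>L 'h)) \<Rightarrow> ('h \<Rightarrow>\<^sub>L 'h)" where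
  "homogeneous_part a k X = (\<Sum>\<alpha> | length \<alpha> = k. scaleC_blinfun (a \<alpha>) (word_eval X \<alpha>))"

lemma eval_series_eq: "eval_series a X = (\<Sum>k. homogeneous_part a k X)"
  by (simp add: eval_series_def homogeneous_part_def)

lemma finite_words [simp]: "finite {\<alpha> :: 'n::finite list. length \<alpha> = k}"
  using finite_lists_length_eq[of "UNIV :: 'n set" k] by simp

lemma finite_words_le [simp]: "finite {\<alpha> :: 'n::finite list. length \<alpha> \<le> k}"
  using finite_lists_length_le[of "UNIV :: 'n set" k] by simp

lemma sum_words_Suc:
  "(\<Sum>\<alpha> :: 'n::finite list | length \<alpha> = Suc k. f \<alpha>) = (\<Sum>i\<in>UNIV. \<Sum>\<alpha> | length \<alpha> = k. f (i # \<alpha>))"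
  unfolding sum.cartesian_product
  by (rule sum.reindex_bij_witness[of _ "\<lambda>(i, \<alpha>). i # \<alpha>" "\<lambda>\<alpha>. (hd \<alpha>, tl \<alpha>)"])
    (auto simp: length_Suc_conv)

lemma coeff_norm_nonneg [simp]: "0 \<le> coeff_norm a k"
  by (simp add: coeff_norm_def L2_set_nonneg)

lemma coeff_norm_Suc: "coeff_norm a (Suc k) = L2_set (\<lambda>i. coeff_norm (\<lambda>\<alpha>. a (i # \<alpha>)) k) UNIV"
  by (simp add: coeff_norm_def L2_set_def sum_words_Suc sum_nonneg)

lemma coeff_le_coeff_norm: "cmod (a \<alpha>) \<le> coeff_norm a (length \<alpha>)"
  unfolding coeff_norm_def by (rule member_le_L2_set) simp_all

lemma coeff_norm_add: "coeff_norm (\<lambda>\<alpha>. a \<alpha> + b \<alpha>) k \<le> coeff_norm a k + coeff_norm b k"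
proof -
  have "coeff_norm (\<lambda>\<alpha>. a \<alpha> + b \<alpha>) k \<le> L2_set (\<lambda>\<alpha>. cmod (a \<alpha>) + cmod (b \<alpha>)) {\<alpha>. length \<alpha> = k}"
    unfolding coeff_norm_def by (intro L2_set_mono norm_triangle_ineq) simp
  also have "\<dots> \<le> coeff_norm a k + coeff_norm b k"
    unfolding coeff_norm_def by (rule L2_set_triangle_ineq)
  finally show ?thesis .
qed

lemma coeff_norm_diff: "coeff_norm (\<lambda>\<alpha>. a \<alpha> - b \<alpha>) k \<le> coeff_norm a k + coeff_norm b k"
  using coeff_norm_add[of a "\<lambda>\<alpha>. - b \<alpha>" k] by (simp add: coeff_norm_def)

section \<open>Operator estimates from coefficient norms\<close>

text \<open>Splitting off the first letter writes the part of degree \<open>Suc k\<close> as the row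
  \<open>X\<close> applied to a column of parts of degree \<open>k\<close>. Each such step costs one
  factor \<open>r\<close> by \<open>row_contraction\<close>, and the coefficient norms of the column
  recombine by \<open>coeff_norm_Suc\<close>.\<close>

lemma norm_homogeneous_part_le:
  fixes X :: "'n::finite \<Rightarrow> ('h::chilbert_space \<Rightarrow>\<^sub>L 'h)"
  assumes X: "X \<in> operator_ball r" and r: "0 \<le> r"
  shows "norm (homogeneous_part a k X) \<le> coeff_norm a k * r ^ k"
proof (rule norm_blinfun_bound)
  show "norm (homogeneous_part a k X x) \<le> coeff_norm a k * r ^ k * norm x" for x
  proof (induction k arbitrary: a)
    case 0
    show ?case
      by (simp add: homogeneous_part_def coeff_norm_def norm_scaleC)
  next
    case (Suc k)
    have lin: "X i (c *\<^sub>C y) = c *\<^sub>C X i y" for i c y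
      using X by (simp add: operator_ball_def bounded_operators_def)
    have "homogeneous_part a (Suc k) X x =
        (\<Sum>i\<in>UNIV. X i (homogeneous_part (\<lambda>\<alpha>. a (i # \<alpha>)) k X x))"
      by (simp add: homogeneous_part_def sum_words_Suc blinfun.sum_left blinfun.sum_right lin)
    also have "norm \<dots> \<le> r * L2_set (\<lambda>i. norm (homogeneous_part (\<lambda>\<alpha>. a (i # \<alpha>)) k X x)) UNIV"
      by (rule row_contraction[OF X r])
    also have "\<dots> \<le> r * L2_set (\<lambda>i. (r ^ k * norm x) * coeff_norm (\<lambda>\<alpha>. a (i # \<alpha>)) k) UNIV"
      using Suc.IH[of "\<lambda>\<alpha>. a (_ # \<alpha>)"]
      by (intro mult_left_mono L2_set_mono r) (simp_all add: mult_ac)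
    also have "L2_set (\<lambda>i. (r ^ k * norm x) * coeff_norm (\<lambda>\<alpha>. a (i # \<alpha>)) k) UNIV =
        r ^ k * norm x * coeff_norm a (Suc k)"
      using r by (simp add: coeff_norm_Suc L2_set_right_distrib)
    finally show ?case by (simp add: mult_ac)
  qed
qed (simp add: r)

text \<open>A coefficient bound at the larger radius \<open>s\<close> makes the homogeneous parts at
  radius \<open>r\<close> decay geometrically with ratio \<open>r / s\<close>.\<close>

lemma eval_series_bound:
  fixes X :: "'n::finite \<Rightarrow> ('h::chilbert_space \<Rightarrow>\<^sub>L 'h)"
  assumes X: "X \<in> operator_ball r" and r: "0 \<le> r" "r < s"
    and C: "\<And>k. coeff_norm a k * s ^ k \<le> C"
  shows "summable (\<lambda>k. homogeneous_part a k X)"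
    and "norm (eval_series a X) \<le> C / (1 - r / s)"
proof -
  have q: "0 \<le> r / s" "r / s < 1" using r by simp_all
  have le: "norm (homogeneous_part a k X) \<le> C * (r / s) ^ k" for k
  proof -
    have "norm (homogeneous_part a k X) \<le> coeff_norm a k * s ^ k * (r / s) ^ k"
      using norm_homogeneous_part_le[OF X r(1)] r by (simp add: power_divide)
    also have "\<dots> \<le> C * (r / s) ^ k" by (intro mult_right_mono C zero_le_power q)
    finally show ?thesis .
  qed
  have sm: "summable (\<lambda>k. C * (r / s) ^ k)"
    using q by (intro summable_mult summable_geometric) simp
  have sn: "summable (\<lambda>k. norm (homogeneous_part a k X))"
    by (rule summable_comparison_test'[OF sm]) (use le in simp)
  show "summable (\<lambda>k. homogeneous_part a k X)" by (rule summable_norm_cancel[OF sn])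
  have "norm (eval_series a X) \<le> (\<Sum>k. norm (homogeneous_part a k X))"
    unfolding eval_series_eq by (rule summable_norm[OF sn])
  also have "\<dots> \<le> (\<Sum>k. C * (r / s) ^ k)" by (rule suminf_le[OF le sn sm])
  also have "\<dots> = C / (1 - r / s)"
    using q by (simp add: suminf_mult suminf_geometric summable_geometric)
  finally show "norm (eval_series a X) \<le> C / (1 - r / s)" .
qed

section \<open>Truncated creation operators and the Cauchy estimate\<close>

text \<open>
  The creation operators of the full Fock space, truncated at words of length \<open>N\<close> and transported to
  \<open>H\<close> along an orthonormal family \<open>e\<close>: they send \<open>e \<alpha>\<close> to \<open>e (i # \<alpha>)\<close> when \<open>\<alpha>\<close> is shorter than
  \<open>N\<close>, and everything orthogonal to these vectors to \<open>0\<close>.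
\<close>

definition truncated_creation ::
    "('n::finite list \<Rightarrow> 'h::chilbert_space) \<Rightarrow> nat \<Rightarrow> 'n \<Rightarrow> ('h \<Rightarrow>\<^sub>L 'h)" where
  "truncated_creation e N i = (\<Sum>\<alpha> | length \<alpha> < N. rank_one (e \<alpha>) (e (i # \<alpha>)))"

lemma finite_words_less [simp]: "finite {\<alpha> :: 'n::finite list. length \<alpha> < k}"
  by (rule finite_subset[OF _ finite_words_le[of k]]) auto

lemma truncated_creation_apply:
  "truncated_creation e N i x = (\<Sum>\<alpha> | length \<alpha> < N. cinner x (e \<alpha>) *\<^sub>C e (i # \<alpha>))"
  by (simp add: truncated_creation_def blinfun.sum_left)

text \<open>Swapping the two vectors of a rank-one operator gives its adjoint; thus the adjoint
  strips the first letter \<open>i\<close>.\<close>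

lemma cadjoint_scaled_truncated_creation:
  "cadjoint (r *\<^sub>R truncated_creation e N i) =
    r *\<^sub>R (\<Sum>\<alpha> | length \<alpha> < N. rank_one (e (i # \<alpha>)) (e \<alpha>))"
proof (rule cadjoint_eqI)
  fix x y
  have "(\<Sum>\<alpha> | length \<alpha> < N. cinner x (e \<alpha>) * cinner (e (i # \<alpha>)) y) =
      (\<Sum>\<alpha> | length \<alpha> < N. cnj (cinner y (e (i # \<alpha>))) * cinner x (e \<alpha>))"
    by (intro sum.cong refl) (metis cinner_commute mult.commute)
  thus "cinner ((r *\<^sub>R truncated_creation e N i) x) y =
      cinner x ((r *\<^sub>R (\<Sum>\<alpha> | length \<alpha> < N. rank_one (e (i # \<alpha>)) (e \<alpha>))) y)"
    by (simp add: truncated_creation_def blinfun.scaleR_left blinfun.sum_left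
        scaleC_of_real[symmetric] cinner_scaleC_left cinner_scaleC_right
        cinner_sum_left cinner_sum_right)
qed

lemma truncated_creation_orthonormal:
  fixes e :: "'n::finite list \<Rightarrow> 'h::chilbert_space"
  assumes e: "orthonormal_on e {\<alpha>. length \<alpha> \<le> N}" and \<alpha>: "length \<alpha> \<le> N"
  shows "truncated_creation e N i (e \<alpha>) = (if length \<alpha> < N then e (i # \<alpha>) else 0)"
proof -
  have "truncated_creation e N i (e \<alpha>) =
      (\<Sum>\<beta> | length \<beta> < N. if \<alpha> = \<beta> then e (i # \<beta>) else 0)"
    unfolding truncated_creation_apply
    using orthonormal_onD[OF e, of \<alpha>] \<alpha> by (intro sum.cong refl) simp
  thus ?thesis by simp
qed

text \<open>Each \<open>?X i o\<^sub>L cadjoint (?X i)\<close> is \<open>r\<^sup>2\<close> times the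
  projection onto the vectors whose word starts with \<open>i\<close>. These ranges are mutually
  orthogonal, so \<open>?T\<close> is \<open>r\<^sup>2\<close> times a single projection and
  \<open>bessel\<close> bounds it.\<close>

lemma truncated_creation_in_operator_ball:
  fixes e :: "'n::finite list \<Rightarrow> 'h::chilbert_space"
  assumes e: "orthonormal_on e {\<alpha>. length \<alpha> \<le> N}" and r: "0 \<le> r"
  shows "(\<lambda>i. r *\<^sub>R truncated_creation e N i) \<in> operator_ball r"
proof -
  let ?X = "\<lambda>i. r *\<^sub>R truncated_creation e N i"
  let ?T = "\<Sum>i\<in>UNIV. ?X i o\<^sub>L cadjoint (?X i)"
  \<comment> \<open>Pairs of a first letter and a remainder index the nonempty words of length at
    most \<open>N\<close>, each exactly once.\<close>
  let ?e = "\<lambda>(i, \<alpha>). e (i # \<alpha>)"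
  let ?A = "(UNIV :: 'n set) \<times> {\<alpha> :: 'n list. length \<alpha> < N}"
  have bounded: "?X i \<in> bounded_operators" for i
    by (simp add: bounded_operators_def blinfun.scaleR_left truncated_creation_apply
        cinner_scaleC_left scaleC_scaleC complex_module.scale_sum_right scaleC_of_real[symmetric]
        mult_ac)
  have e': "orthonormal_on ?e ?A"
    using e by (auto simp: orthonormal_on_def)
  have row: "?X i (cadjoint (?X i) y) =
      r\<^sup>2 *\<^sub>R (\<Sum>\<alpha> | length \<alpha> < N. cinner y (e (i # \<alpha>)) *\<^sub>C e (i # \<alpha>))" for i y
  proof -
    have less: "orthonormal_on e {\<alpha>. length \<alpha> < N}"
      using e by (simp add: orthonormal_on_def)
    have "(\<Sum>\<alpha> | length \<alpha> < N.
          cinner (\<Sum>\<beta> | length \<beta> < N. cinner y (e (i # \<beta>)) *\<^sub>C e \<beta>) (e \<alpha>) *\<^sub>C e (i # \<alpha>)) =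
        (\<Sum>\<alpha> | length \<alpha> < N. cinner y (e (i # \<alpha>)) *\<^sub>C e (i # \<alpha>))"
      by (intro sum.cong refl) (simp add: cinner_orthonormal_sum_left[OF finite_words_less less])
    thus ?thesis
      by (simp add: cadjoint_scaled_truncated_creation blinfun.scaleR_left blinfun.scaleR_right
          blinfun.sum_left truncated_creation_apply power2_eq_square)
  qed
  have "norm (?T y) \<le> r\<^sup>2 * norm y" for y
  proof -
    have "?T y = r\<^sup>2 *\<^sub>R (\<Sum>a\<in>?A. cinner y (?e a) *\<^sub>C ?e a)"
      by (simp add: blinfun.sum_left row scaleR_sum_right[symmetric] sum.cartesian_product
          case_prod_unfold)
    also have "norm \<dots> \<le> r\<^sup>2 * norm y"
      using bessel[OF _ e', of y] by (simp add: mult_left_mono)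
    finally show ?thesis .
  qed
  hence "norm ?T \<le> r\<^sup>2" by (intro norm_blinfun_bound) simp_all
  hence "sqrt (norm ?T) \<le> r" using r by (simp add: real_le_lsqrt)
  with bounded show ?thesis by (simp add: operator_ball_def)
qed

lemma word_eval_truncated_creation:
  assumes e: "orthonormal_on e {\<alpha>. length \<alpha> \<le> N}"
  shows "word_eval (\<lambda>i. r *\<^sub>R truncated_creation e N i) \<alpha> (e []) =
    (if length \<alpha> \<le> N then r ^ length \<alpha> *\<^sub>R e \<alpha> else 0)"
proof (induction \<alpha>)
  case (Cons i \<alpha>)
  thus ?case
    using truncated_creation_orthonormal[OF e, of \<alpha> i]
    by (simp add: blinfun.scaleR_left blinfun.scaleR_right)
qed simp

text \<open>Truncation at length \<open>k\<close> needs only a finite orthonormal family while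
  keeping degree \<open>k\<close> intact. Applied to the vacuum \<open>e []\<close>, the series
  becomes the vector of weighted coefficients up to that degree.\<close>

lemma cauchy_estimate:
  fixes a :: "'n::finite power_series"
  assumes infinite_dim: "\<nexists>B :: 'h::chilbert_space set. finite B \<and> module.span scaleC B = UNIV"
    and r: "0 \<le> r" "r < s" and s: "\<And>k. coeff_norm a k * s ^ k \<le> C"
    and M: "\<And>X :: 'n \<Rightarrow> ('h \<Rightarrow>\<^sub>L 'h). X \<in> operator_ball r \<Longrightarrow> norm (eval_series a X) \<le> M"
  shows "coeff_norm a k * r ^ k \<le> M"
proof -
  let ?A = "{\<alpha> :: 'n list. length \<alpha> \<le> k}"
  obtain e :: "'n list \<Rightarrow> 'h" where e: "orthonormal_on e ?A"
    using orthonormal_family_exists[OF infinite_dim finite_words_le] .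
  define X where "X = (\<lambda>i. r *\<^sub>R truncated_creation e k i)"
  have X: "X \<in> operator_ball r"
    unfolding X_def by (rule truncated_creation_in_operator_ball[OF e r(1)])
  have part: "homogeneous_part a j X (e []) =
      (if j \<le> k then \<Sum>\<alpha> | length \<alpha> = j. (a \<alpha> * r ^ length \<alpha>) *\<^sub>C e \<alpha> else 0)" for j
    by (auto simp: homogeneous_part_def blinfun.sum_left X_def word_eval_truncated_creation[OF e]
        scaleC_of_real[symmetric] scaleC_scaleC intro!: sum.cong)
  \<comment> \<open>Evaluation at a vector is bounded and linear, hence passes through the sum; the
    bound at radius \<open>s\<close> supplies the summability.\<close>
  have "eval_series a X (e []) = (\<Sum>j. homogeneous_part a j X (e []))"
    unfolding eval_series_eq
    by (rule bounded_linear.suminf[OF blinfun.bounded_linear_left])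
      (rule eval_series_bound(1)[OF X r s])
  also have "\<dots> = (\<Sum>j\<le>k. \<Sum>\<alpha> | length \<alpha> = j. (a \<alpha> * r ^ length \<alpha>) *\<^sub>C e \<alpha>)"
    by (subst suminf_finite[of "{..k}"]) (simp_all add: part)
  also have "\<dots> = (\<Sum>j\<le>k. \<Sum>\<alpha> | \<alpha> \<in> ?A \<and> length \<alpha> = j. (a \<alpha> * r ^ length \<alpha>) *\<^sub>C e \<alpha>)"
    by (intro sum.cong) auto
  also have "\<dots> = (\<Sum>\<alpha>\<in>?A. (a \<alpha> * r ^ length \<alpha>) *\<^sub>C e \<alpha>)"
    by (rule sum.group) auto
  finally have eval: "norm (eval_series a X (e [])) = L2_set (\<lambda>\<alpha>. cmod (a \<alpha> * r ^ length \<alpha>)) ?A"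
    by (simp add: norm_orthonormal_sum[OF finite_words_le e])
  have "coeff_norm a k * r ^ k = L2_set (\<lambda>\<alpha>. cmod (a \<alpha>) * r ^ k) {\<alpha>. length \<alpha> = k}"
    using r by (simp add: coeff_norm_def L2_set_left_distrib)
  also have "\<dots> = L2_set (\<lambda>\<alpha>. cmod (a \<alpha> * r ^ length \<alpha>)) {\<alpha>. length \<alpha> = k}"
    using r by (intro L2_set_cong refl) (simp add: norm_mult norm_power)
  \<comment> \<open>All degrees below \<open>k\<close> are discarded.\<close>
  also have "\<dots> \<le> L2_set (\<lambda>\<alpha>. cmod (a \<alpha> * r ^ length \<alpha>)) ?A"
    unfolding L2_set_def by (intro real_sqrt_le_mono sum_mono2) auto
  also have "\<dots> \<le> norm (eval_series a X) * norm (e [])"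
    unfolding eval[symmetric] by (rule norm_blinfun)
  also have "norm (e []) = 1"
    using orthonormal_onD[OF e, of "[]" "[]"] by (simp add: norm_eq_sqrt_inner inner_eq_Re_cinner)
  finally show ?thesis using M[OF X] by simp
qed

section \<open>Growth of the coefficients\<close>

lemma powr_root_half:
  assumes "0 \<le> x" "0 < k"
  shows "(x powr (1 / (2 * real k))) ^ k = sqrt x"
  using assms by (cases "x = 0") (simp_all add: powr_power powr_half_sqrt)

text \<open>The Cauchy-Hadamard criterion: the growth condition is recast as boundedness at every
  radius below 1, which avoids roots from here on.\<close>

lemma free_holomorphic_iff:
  "a \<in> free_holomorphic \<longleftrightarrow> (\<forall>r. 0 < r \<longrightarrow> r < 1 \<longrightarrow> Bseq (\<lambda>k. coeff_norm a k * r ^ k))"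
proof -
  define x where "x k = (\<Sum>\<alpha> | length \<alpha> = k. (cmod (a \<alpha>))\<^sup>2) powr (1 / (2 * real k))" for k
  have hol: "a \<in> free_holomorphic \<longleftrightarrow> limsup (\<lambda>k. ereal (x k)) \<le> 1"
    by (simp only: free_holomorphic_def mem_Collect_eq x_def)
  \<comment> \<open>Degree 0 is excluded: there \<open>1 / (2 * real k)\<close> is 0 by the
    convention for division by zero, and the root loses the coefficient.\<close>
  have root: "x k < s \<longleftrightarrow> coeff_norm a k < s ^ k" if "0 < k" "0 < s" for k s
  proof -
    have "x k ^ k = sqrt (\<Sum>\<alpha> | length \<alpha> = k. (cmod (a \<alpha>))\<^sup>2)"
      unfolding x_def by (rule powr_root_half[OF sum_nonneg that(1)]) simp
    hence "x k ^ k = coeff_norm a k" by (simp add: coeff_norm_def L2_set_def)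
    moreover have "x k ^ k < s ^ k \<longleftrightarrow> x k < s"
      unfolding not_le[symmetric] using that by (subst power_mono_iff) (simp_all add: x_def)
    ultimately show ?thesis by (simp only:)
  qed
  show ?thesis
  proof (intro iffI allI impI)
    fix r :: real assume a: "a \<in> free_holomorphic" and r: "0 < r" "r < 1"
    have "limsup (\<lambda>k. ereal (x k)) < ereal (1 / r)"
      using a r unfolding hol by (elim le_less_trans) simp
    hence "\<forall>\<^sub>F k in sequentially. x k < 1 / r"
      by (auto dest: Limsup_lessD)
    hence "\<forall>\<^sub>F k in sequentially. norm (coeff_norm a k * r ^ k) \<le> 1"
      using eventually_gt_at_top[of 0]
    proof eventually_elim
      case (elim k)
      hence "coeff_norm a k < (1 / r) ^ k" using root[of k "1 / r"] r by simp
      thus ?case using r by (simp add: power_divide field_simps)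
    qed
    thus "Bseq (\<lambda>k. coeff_norm a k * r ^ k)" by (rule BfunI)
  next
    assume B: "\<forall>r. 0 < r \<longrightarrow> r < 1 \<longrightarrow> Bseq (\<lambda>k. coeff_norm a k * r ^ k)"
    have ev: "\<forall>\<^sub>F k in sequentially. x k < y" if y: "1 < y" for y
    proof -
      \<comment> \<open>With this radius \<open>y ^ k\<close> splits into two factors
        \<open>sqrt y ^ k\<close>: one undoes the weight \<open>r ^ k\<close>, the other eventually
        exceeds \<open>C\<close>.\<close>
      define r where "r = 1 / sqrt y"
      have sq: "1 < sqrt y" using y by simp
      have r: "0 < r" "r < 1" using sq by (simp_all add: r_def)
      obtain C where C: "C > 0" "\<And>k. norm (coeff_norm a k * r ^ k) \<le> C"
        using B r by (meson BseqE)
      have "\<forall>\<^sub>F k in sequentially. C < sqrt y ^ k"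
        using filterlim_realpow_sequentially_gt1[of "sqrt y"] sq
        by (auto simp: filterlim_at_infinity_conv_norm_at_top filterlim_at_top_dense norm_power)
      thus ?thesis using eventually_gt_at_top[of 0]
      proof eventually_elim
        case (elim k)
        have "coeff_norm a k \<le> C * sqrt y ^ k"
          using C(2)[of k] sq by (simp add: r_def power_divide field_simps)
        also have "\<dots> < sqrt y ^ k * sqrt y ^ k"
          using elim sq by simp
        also have "\<dots> = y ^ k" using y by (simp flip: power_mult_distrib)
        finally show ?case using root[of k y] elim y by simp
      qed
    qed
    have "limsup (\<lambda>k. ereal (x k)) \<le> 1"
      unfolding Limsup_le_iff
    proof (intro allI impI)
      fix y :: ereal assume "1 < y"
      thus "\<forall>\<^sub>F k in sequentially. ereal (x k) < y"
        by (cases y) (simp_all add: ev)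
    qed
    thus "a \<in> free_holomorphic" by (simp only: hol)
  qed
qed

lemma free_holomorphic_bound:
  assumes "a \<in> free_holomorphic" "0 < r" "r < 1"
  obtains C where "\<And>k. coeff_norm a k * r ^ k \<le> C"
proof -
  have "Bseq (\<lambda>k. coeff_norm a k * r ^ k)" using assms by (simp add: free_holomorphic_iff)
  then obtain C where "\<And>k. norm (coeff_norm a k * r ^ k) \<le> C" by (meson BseqE)
  hence "coeff_norm a k * r ^ k \<le> C" for k by (simp add: abs_le_iff)
  thus thesis by (rule that)
qed

lemma free_holomorphic_diff:
  assumes "a \<in> free_holomorphic" "b \<in> free_holomorphic"
  shows "(\<lambda>\<alpha>. a \<alpha> - b \<alpha>) \<in> free_holomorphic"
  unfolding free_holomorphic_iff
proof (intro allI impI)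
  fix r :: real assume r: "0 < r" "r < 1"
  obtain C D where C: "\<And>k. coeff_norm a k * r ^ k \<le> C" and D: "\<And>k. coeff_norm b k * r ^ k \<le> D"
    using free_holomorphic_bound assms r by metis
  have "norm (coeff_norm (\<lambda>\<alpha>. a \<alpha> - b \<alpha>) k * r ^ k) \<le> C + D" for k
  proof -
    have "coeff_norm (\<lambda>\<alpha>. a \<alpha> - b \<alpha>) k * r ^ k \<le> (coeff_norm a k + coeff_norm b k) * r ^ k"
      using r by (intro mult_right_mono coeff_norm_diff) simp
    thus ?thesis using C[of k] D[of k] r by (simp add: algebra_simps)
  qed
  thus "Bseq (\<lambda>k. coeff_norm (\<lambda>\<alpha>. a \<alpha> - b \<alpha>) k * r ^ k)" by (rule BseqI')
qed

lemma eval_series_diff: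
  fixes X :: "'n::finite \<Rightarrow> ('h::chilbert_space \<Rightarrow>\<^sub>L 'h)"
  assumes "a \<in> free_holomorphic" "b \<in> free_holomorphic" and X: "X \<in> operator_ball r"
    and r: "0 \<le> r" "r < 1"
  shows "eval_series (\<lambda>\<alpha>. a \<alpha> - b \<alpha>) X = eval_series a X - eval_series b X"
proof -
  have "summable (\<lambda>k. homogeneous_part c k X)" if c: "c \<in> free_holomorphic" for c
  proof -
    \<comment> \<open>Boundedness at a radius yields summability only at smaller radii, hence the
      intermediate \<open>s\<close>.\<close>
    obtain s where s: "r < s" "s < 1" using r dense by blast
    then obtain C where "\<And>k. coeff_norm c k * s ^ k \<le> C"
      using free_holomorphic_bound[OF c] r by (metis le_less_trans)
    thus ?thesis by (rule eval_series_bound(1)[OF X r(1) s(1)])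
  qed
  moreover have "scaleC_blinfun (c - d) T = scaleC_blinfun c T - scaleC_blinfun d T"
    for c d and T :: "'h \<Rightarrow>\<^sub>L 'h"
    by (rule blinfun_eqI) (simp add: blinfun.diff_left complex_module.scale_left_diff_distrib)
  hence "homogeneous_part (\<lambda>\<alpha>. a \<alpha> - b \<alpha>) k X = homogeneous_part a k X - homogeneous_part b k X"
    for k by (simp add: homogeneous_part_def sum_subtractf)
  ultimately show ?thesis
    using assms by (simp add: eval_series_eq suminf_diff)
qed

section \<open>Convergence of the coefficients\<close>

text \<open>Convergence in all weighted seminorms given by the supremum over \<open>k\<close>. The
  non-strict inequality survives passage to limits.\<close>

definition coeff_converges :: "(nat \<Rightarrow> 'n::finite power_series) \<Rightarrow> 'n power_series \<Rightarrow> bool" where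
  "coeff_converges F G \<longleftrightarrow> (\<forall>r e. 0 < r \<longrightarrow> r < 1 \<longrightarrow> 0 < e \<longrightarrow>
    (\<forall>\<^sub>F m in sequentially. \<forall>k. coeff_norm (\<lambda>\<alpha>. F m \<alpha> - G \<alpha>) k * r ^ k \<le> e))"

lemma coeff_convergesD:
  "coeff_converges F G \<Longrightarrow> 0 < r \<Longrightarrow> r < 1 \<Longrightarrow> 0 < e \<Longrightarrow>
    \<forall>\<^sub>F m in sequentially. \<forall>k. coeff_norm (\<lambda>\<alpha>. F m \<alpha> - G \<alpha>) k * r ^ k \<le> e"
  by (simp add: coeff_converges_def)

lemma coeff_converges_imp_uniform_limit:
  fixes F :: "nat \<Rightarrow> 'n::finite power_series"
  assumes F: "\<And>m. F m \<in> free_holomorphic" and G: "G \<in> free_holomorphic"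
    and conv: "coeff_converges F G" and r: "0 \<le> r" "r < 1"
  shows "uniform_limit (operator_ball r :: ('n \<Rightarrow> ('h::chilbert_space \<Rightarrow>\<^sub>L 'h)) set)
    (\<lambda>m X. eval_series (F m) X) (\<lambda>X. eval_series G X) sequentially"
proof (rule uniform_limitI)
  fix e :: real assume e: "0 < e"
  obtain s where s: "r < s" "s < 1" using r dense by blast
  \<comment> \<open>The reciprocal of the geometric sum in \<open>eval_series_bound\<close>; halving
    \<open>e\<close> below makes the final inequality strict.\<close>
  define c where "c = 1 - r / s"
  have c: "0 < c" using r s by (simp add: c_def)
  have "\<forall>\<^sub>F m in sequentially. \<forall>k. coeff_norm (\<lambda>\<alpha>. F m \<alpha> - G \<alpha>) k * s ^ k \<le> e / 2 * c"
    using r s e c by (intro coeff_convergesD[OF conv]) auto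
  thus "\<forall>\<^sub>F m in sequentially. \<forall>X\<in>operator_ball r :: ('n \<Rightarrow> ('h \<Rightarrow>\<^sub>L 'h)) set.
      dist (eval_series (F m) X) (eval_series G X) < e"
  proof eventually_elim
    case (elim m)
    show ?case
    proof
      fix X :: "'n \<Rightarrow> ('h \<Rightarrow>\<^sub>L 'h)" assume X: "X \<in> operator_ball r"
      have "dist (eval_series (F m) X) (eval_series G X) = norm (eval_series (\<lambda>\<alpha>. F m \<alpha> - G \<alpha>) X)"
        by (simp add: dist_norm eval_series_diff[OF F G X r])
      also have "\<dots> \<le> e / 2 * c / (1 - r / s)"
        using elim by (intro eval_series_bound(2)[OF X r(1) s(1)]) blast
      also have "\<dots> < e" using c e by (simp add: c_def[symmetric])
      finally show "dist (eval_series (F m) X) (eval_series G X) < e" .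
    qed
  qed
qed

section \<open>Hausdorff derivations and coefficient norms\<close>

lemma coeff_norm_sum: "coeff_norm (\<lambda>\<alpha>. \<Sum>p\<in>P. f p \<alpha>) k \<le> (\<Sum>p\<in>P. coeff_norm (f p) k)"
proof (induction P rule: infinite_finite_induct)
  case (insert p P)
  thus ?case using coeff_norm_add[of "f p" "\<lambda>\<alpha>. \<Sum>p\<in>P. f p \<alpha>" k] by simp
qed (simp_all add: coeff_norm_def L2_set_0')

text \<open>A coefficient of the derivative sums over the \<open>k + 1\<close> positions where
  \<open>i\<close> can be inserted. For a fixed position insertion is injective, so each summand
  contributes at most the full norm in degree \<open>Suc k\<close>.\<close>

lemma coeff_norm_hausdorff_deriv: "coeff_norm (hausdorff_deriv i a) k \<le> Suc k * coeff_norm a (Suc k)"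
proof -
  let ?w = "\<lambda>p \<beta>. take p \<beta> @ i # drop p \<beta>"
  have "coeff_norm (hausdorff_deriv i a) k = coeff_norm (\<lambda>\<beta>. \<Sum>p\<le>k. a (?w p \<beta>)) k"
    unfolding coeff_norm_def by (intro L2_set_cong refl) (simp add: hausdorff_deriv_eq)
  also have "\<dots> \<le> (\<Sum>p\<le>k. coeff_norm (\<lambda>\<beta>. a (?w p \<beta>)) k)"
    by (rule coeff_norm_sum)
  also have "\<dots> \<le> (\<Sum>p\<le>k. coeff_norm a (Suc k))"
  proof (rule sum_mono)
    fix p assume p: "p \<in> {..k}"
    have inj: "inj_on (?w p) {\<beta>. length \<beta> = k}"
    proof (rule inj_onI)
      fix \<beta> \<gamma> assume "\<beta> \<in> {\<beta>. length \<beta> = k}" "\<gamma> \<in> {\<beta>. length \<beta> = k}" "?w p \<beta> = ?w p \<gamma>"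
      hence "take p \<beta> = take p \<gamma>" "drop p \<beta> = drop p \<gamma>" by simp_all
      thus "\<beta> = \<gamma>" by (metis append_take_drop_id)
    qed
    have "(\<Sum>\<beta> | length \<beta> = k. (cmod (a (?w p \<beta>)))\<^sup>2) =
        (\<Sum>\<alpha>\<in>?w p ` {\<beta>. length \<beta> = k}. (cmod (a \<alpha>))\<^sup>2)"
      by (simp add: sum.reindex[OF inj])
    also have "\<dots> \<le> (\<Sum>\<alpha> | length \<alpha> = Suc k. (cmod (a \<alpha>))\<^sup>2)"
      using p by (intro sum_mono2) auto
    finally show "coeff_norm (\<lambda>\<beta>. a (?w p \<beta>)) k \<le> coeff_norm a (Suc k)"
      by (simp add: coeff_norm_def L2_set_def)
  qed
  finally show ?thesis by simp
qed

text \<open>The left side is \<open>k + 1\<close> copies of the smallest among the first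
  \<open>k + 1\<close> terms of the geometric series.\<close>

lemma Suc_mult_power_le:
  fixes q :: real
  assumes "0 \<le> q" "q < 1"
  shows "Suc k * q ^ k \<le> 1 / (1 - q)"
proof -
  have "Suc k * q ^ k = (\<Sum>j<Suc k. q ^ k)" by simp
  also have "\<dots> \<le> (\<Sum>j<Suc k. q ^ j)"
    using assms by (intro sum_mono power_decreasing) auto
  also have "\<dots> \<le> (\<Sum>j. q ^ j)"
    using assms by (intro sum_le_suminf summable_geometric) auto
  finally show ?thesis using assms by (simp add: suminf_geometric)
qed

lemma hausdorff_deriv_bound:
  assumes r: "0 < r" "r < 1"
  obtains s K where "0 < s" "s < 1" "0 < K"
    "\<And>i (a :: 'n::finite power_series) k.
      coeff_norm (hausdorff_deriv i a) k * r ^ k \<le> K * (coeff_norm a (Suc k) * s ^ Suc k)"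
proof -
  obtain s where s: "r < s" "s < 1" using r dense by blast
  \<comment> \<open>The first quotient absorbs \<open>Suc k * (r / s) ^ k\<close>; the division by
    \<open>s\<close> pays for the shift from \<open>s ^ k\<close> to
    \<open>s ^ Suc k\<close>.\<close>
  define K where "K = 1 / (1 - r / s) / s"
  show thesis
  proof (rule that[of s K])
    show "0 < s" "s < 1" "0 < K" using r s by (simp_all add: K_def)
    fix i and a :: "'n power_series" and k
    have "coeff_norm (hausdorff_deriv i a) k * r ^ k \<le> Suc k * coeff_norm a (Suc k) * r ^ k"
      using r by (intro mult_right_mono coeff_norm_hausdorff_deriv) simp
    also have "\<dots> = (Suc k * (r / s) ^ k) * (coeff_norm a (Suc k) * s ^ k)"
      using r s by (simp add: power_divide)
    also have "\<dots> \<le> 1 / (1 - r / s) * (coeff_norm a (Suc k) * s ^ k)"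
      using r s by (intro mult_right_mono Suc_mult_power_le) simp_all
    also have "\<dots> = K * (coeff_norm a (Suc k) * s ^ Suc k)"
      using r s by (simp add: K_def)
    finally show "coeff_norm (hausdorff_deriv i a) k * r ^ k \<le> K * (coeff_norm a (Suc k) * s ^ Suc k)" .
  qed
qed

lemma free_holomorphic_hausdorff_deriv:
  assumes a: "a \<in> free_holomorphic"
  shows "hausdorff_deriv i a \<in> free_holomorphic"
  unfolding free_holomorphic_iff
proof (intro allI impI)
  fix r :: real assume "0 < r" "r < 1"
  then obtain s K where s: "0 < s" "s < 1" and K: "0 < K"
    and le: "\<And>k. coeff_norm (hausdorff_deriv i a) k * r ^ k \<le> K * (coeff_norm a (Suc k) * s ^ Suc k)"
    using hausdorff_deriv_bound by metis
  obtain C where C: "\<And>k. coeff_norm a k * s ^ k \<le> C" using free_holomorphic_bound[OF a s] by blast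
  have "norm (coeff_norm (hausdorff_deriv i a) k * r ^ k) \<le> K * C" for k
    using order_trans[OF le mult_left_mono[OF C]] K \<open>0 < r\<close> by simp
  thus "Bseq (\<lambda>k. coeff_norm (hausdorff_deriv i a) k * r ^ k)" by (rule BseqI')
qed

lemma coeff_converges_hausdorff_deriv:
  assumes conv: "coeff_converges F G"
  shows "coeff_converges (\<lambda>m. hausdorff_deriv i (F m)) (hausdorff_deriv i G)"
  unfolding coeff_converges_def
proof (intro allI impI)
  fix r e :: real assume "0 < r" "r < 1" and e: "0 < e"
  then obtain s K where s: "0 < s" "s < 1" and K: "0 < K"
    and le: "\<And>a k. coeff_norm (hausdorff_deriv i a) k * r ^ k \<le> K * (coeff_norm a (Suc k) * s ^ Suc k)"
    using hausdorff_deriv_bound by metis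
  have "\<forall>\<^sub>F m in sequentially. \<forall>k. coeff_norm (\<lambda>\<alpha>. F m \<alpha> - G \<alpha>) k * s ^ k \<le> e / K"
    using s e K by (intro coeff_convergesD[OF conv]) auto
  thus "\<forall>\<^sub>F m in sequentially. \<forall>k.
      coeff_norm (\<lambda>\<alpha>. hausdorff_deriv i (F m) \<alpha> - hausdorff_deriv i G \<alpha>) k * r ^ k \<le> e"
  proof eventually_elim
    case (elim m)
    have "coeff_norm (\<lambda>\<alpha>. hausdorff_deriv i (F m) \<alpha> - hausdorff_deriv i G \<alpha>) k * r ^ k \<le> e" for k
    proof -
      \<comment> \<open>By linearity \<open>le\<close> applies to the single series
        \<open>F m - G\<close>; the shift in degree is harmless because \<open>elim\<close> covers
        all degrees.\<close>
      have "(\<lambda>\<alpha>. hausdorff_deriv i (F m) \<alpha> - hausdorff_deriv i G \<alpha>) =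
          hausdorff_deriv i (\<lambda>\<alpha>. F m \<alpha> - G \<alpha>)"
        using hausdorff_deriv_linear[of i 1 "F m" "-1" G] by simp
      hence "coeff_norm (\<lambda>\<alpha>. hausdorff_deriv i (F m) \<alpha> - hausdorff_deriv i G \<alpha>) k * r ^ k \<le>
          K * (coeff_norm (\<lambda>\<alpha>. F m \<alpha> - G \<alpha>) (Suc k) * s ^ Suc k)"
        using le by simp
      also have "\<dots> \<le> K * (e / K)"
        using elim K by (intro mult_left_mono) (blast, simp)
      finally show ?thesis using K by simp
    qed
    thus ?case by blast
  qed
qed

lemma free_holomorphic_hausdorff_derivs:
  "a \<in> free_holomorphic \<Longrightarrow> hausdorff_derivs is a \<in> free_holomorphic"
  by (induction "is") (simp_all add: hausdorff_derivs_def free_holomorphic_hausdorff_deriv)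

lemma coeff_converges_hausdorff_derivs:
  "coeff_converges F G \<Longrightarrow>
    coeff_converges (\<lambda>m. hausdorff_derivs is (F m)) (hausdorff_derivs is G)"
  by (induction "is") (simp_all add: hausdorff_derivs_def coeff_converges_hausdorff_deriv)

section \<open>Completeness of coefficient convergence\<close>

lemma coeff_cauchy_imp_converges:
  fixes F :: "nat \<Rightarrow> 'n::finite power_series"
  assumes F: "\<And>m. F m \<in> free_holomorphic"
    and cauchy: "\<And>r e. 0 < r \<Longrightarrow> r < 1 \<Longrightarrow> 0 < e \<Longrightarrow>
      \<exists>N. \<forall>m\<ge>N. \<forall>p\<ge>N. \<forall>k. coeff_norm (\<lambda>\<alpha>. F m \<alpha> - F p \<alpha>) k * r ^ k \<le> e"
  obtains G where "G \<in> free_holomorphic" "coeff_converges F G"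
proof -
  have "convergent (\<lambda>m. F m \<alpha>)" for \<alpha>
  proof (rule Cauchy_convergent, rule metric_CauchyI)
    fix e :: real assume e: "0 < e"
    \<comment> \<open>The weight of degree \<open>length \<alpha>\<close> at radius 1/2, included in
      the tolerance so that it cancels and leaves \<open>e / 2\<close>.\<close>
    let ?d = "(1 / 2) ^ length \<alpha> :: real"
    obtain N where N: "\<And>m p k. m \<ge> N \<Longrightarrow> p \<ge> N \<Longrightarrow>
        coeff_norm (\<lambda>\<alpha>. F m \<alpha> - F p \<alpha>) k * (1 / 2) ^ k \<le> e / 2 * ?d"
      using cauchy[of "1 / 2" "e / 2 * ?d"] e by auto
    have "dist (F m \<alpha>) (F p \<alpha>) < e" if "m \<ge> N" "p \<ge> N" for m p
    proof -
      have "coeff_norm (\<lambda>\<alpha>. F m \<alpha> - F p \<alpha>) (length \<alpha>) \<le> e / 2"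
        using N[OF that, of "length \<alpha>"] by (subst (asm) mult_le_cancel_right) simp
      thus ?thesis
        using coeff_le_coeff_norm[of "\<lambda>\<alpha>. F m \<alpha> - F p \<alpha>" \<alpha>] e by (simp add: dist_norm)
    qed
    thus "\<exists>N. \<forall>m\<ge>N. \<forall>p\<ge>N. dist (F m \<alpha>) (F p \<alpha>) < e" by blast
  qed
  then obtain G where G: "\<And>\<alpha>. (\<lambda>m. F m \<alpha>) \<longlonglongrightarrow> G \<alpha>"
    unfolding convergent_def by metis
  have lim: "\<exists>N. \<forall>m\<ge>N. \<forall>k. coeff_norm (\<lambda>\<alpha>. F m \<alpha> - G \<alpha>) k * r ^ k \<le> e"
    if r: "0 < r" "r < 1" and e: "0 < e" for r e :: real
  proof -
    obtain N where N: "\<And>m p k. m \<ge> N \<Longrightarrow> p \<ge> N \<Longrightarrow>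
        coeff_norm (\<lambda>\<alpha>. F m \<alpha> - F p \<alpha>) k * r ^ k \<le> e"
      using cauchy[OF r e] by blast
    \<comment> \<open>In one degree only finitely many coefficients occur, so \<open>p\<close> may
      tend to infinity; \<open>N\<close> was chosen before \<open>k\<close>, which keeps the bound
      uniform.\<close>
    have "coeff_norm (\<lambda>\<alpha>. F m \<alpha> - G \<alpha>) k * r ^ k \<le> e" if m: "m \<ge> N" for m k
    proof (rule tendsto_upperbound)
      show "(\<lambda>p. coeff_norm (\<lambda>\<alpha>. F m \<alpha> - F p \<alpha>) k * r ^ k) \<longlonglongrightarrow>
          coeff_norm (\<lambda>\<alpha>. F m \<alpha> - G \<alpha>) k * r ^ k"
        unfolding coeff_norm_def L2_set_def by (intro tendsto_intros G)
      show "\<forall>\<^sub>F p in sequentially. coeff_norm (\<lambda>\<alpha>. F m \<alpha> - F p \<alpha>) k * r ^ k \<le> e"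
        using eventually_ge_at_top[of N] by eventually_elim (rule N[OF m])
    qed simp
    thus ?thesis by blast
  qed
  have conv: "coeff_converges F G"
    unfolding coeff_converges_def eventually_sequentially using lim by blast
  have "G \<in> free_holomorphic"
    unfolding free_holomorphic_iff
  proof (intro allI impI)
    fix r :: real assume r: "0 < r" "r < 1"
    \<comment> \<open>One \<open>m\<close> at distance 1 suffices, since \<open>G\<close> is
      \<open>F m\<close> minus \<open>F m - G\<close>.\<close>
    obtain m where m: "\<And>k. coeff_norm (\<lambda>\<alpha>. F m \<alpha> - G \<alpha>) k * r ^ k \<le> 1"
      using lim[OF r, of 1] by auto
    obtain C where C: "\<And>k. coeff_norm (F m) k * r ^ k \<le> C"
      using free_holomorphic_bound[OF F r] by blast
    have "norm (coeff_norm G k * r ^ k) \<le> C + 1" for k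
    proof -
      have "coeff_norm G k * r ^ k \<le> (coeff_norm (F m) k + coeff_norm (\<lambda>\<alpha>. F m \<alpha> - G \<alpha>) k) * r ^ k"
        using coeff_norm_diff[of "F m" "\<lambda>\<alpha>. F m \<alpha> - G \<alpha>" k] r by (intro mult_right_mono) simp_all
      thus ?thesis using m[of k] C[of k] r by (simp add: algebra_simps)
    qed
    thus "Bseq (\<lambda>k. coeff_norm G k * r ^ k)" by (rule BseqI')
  qed
  thus thesis using conv by (rule that)
qed

section \<open>Transfer between operator balls and coefficients\<close>

theorem theorem5p1:
  fixes F :: "nat \<Rightarrow> 'n::finite power_series"
  assumes infinite_dim: "\<nexists>B :: 'h::chilbert_space set. finite B \<and> module.span scaleC B = UNIV"
    and hol: "\<And>m. F m \<in> free_holomorphic"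
    and conv: "\<And>r. 0 \<le> r \<Longrightarrow> r < 1 \<Longrightarrow>
      uniformly_convergent_on (operator_ball r :: ('n \<Rightarrow> ('h \<Rightarrow>\<^sub>L 'h)) set) (\<lambda>m X. eval_series (F m) X)"
  shows "\<exists>G \<in> free_holomorphic.
      (\<forall>r. 0 \<le> r \<and> r < 1 \<longrightarrow>
        uniform_limit (operator_ball r :: ('n \<Rightarrow> ('h \<Rightarrow>\<^sub>L 'h)) set)
          (\<lambda>m X. eval_series (F m) X) (\<lambda>X. eval_series G X) sequentially) \<and>
      (\<forall>is. \<forall>r. 0 \<le> r \<and> r < 1 \<longrightarrow>
        uniform_limit (operator_ball r :: ('n \<Rightarrow> ('h \<Rightarrow>\<^sub>L 'h)) set)
          (\<lambda>m X. eval_series (hausdorff_derivs is (F m)) X)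
          (\<lambda>X. eval_series (hausdorff_derivs is G) X) sequentially)"
proof -
  have cauchy: "\<exists>N. \<forall>m\<ge>N. \<forall>p\<ge>N. \<forall>k. coeff_norm (\<lambda>\<alpha>. F m \<alpha> - F p \<alpha>) k * r ^ k \<le> e"
    if r: "0 < r" "r < 1" and e: "0 < e" for r e :: real
  proof -
    \<comment> \<open>The limit is not yet known to be a power series, so the Cauchy estimate is
      applied to the differences of \<open>F m\<close> and \<open>F p\<close>.\<close>
    have "uniformly_Cauchy_on (operator_ball r :: ('n \<Rightarrow> ('h \<Rightarrow>\<^sub>L 'h)) set) (\<lambda>m X. eval_series (F m) X)"
      using conv[of r] r by (intro uniformly_convergent_Cauchy) simp
    then obtain N where N: "\<And>m p (X :: 'n \<Rightarrow> ('h \<Rightarrow>\<^sub>L 'h)). m \<ge> N \<Longrightarrow> p \<ge> N \<Longrightarrow>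
        X \<in> operator_ball r \<Longrightarrow> dist (eval_series (F m) X) (eval_series (F p) X) < e"
      using e unfolding uniformly_Cauchy_on_def by metis
    \<comment> \<open>The larger radius gives the a priori coefficient bound that
      \<open>cauchy_estimate\<close> requires; its constant may depend on \<open>m\<close> and
      \<open>p\<close>.\<close>
    obtain s where s: "r < s" "s < 1" using r dense by blast
    have "coeff_norm (\<lambda>\<alpha>. F m \<alpha> - F p \<alpha>) k * r ^ k \<le> e" if mp: "m \<ge> N" "p \<ge> N" for m p k
    proof -
      obtain C where C: "\<And>k. coeff_norm (\<lambda>\<alpha>. F m \<alpha> - F p \<alpha>) k * s ^ k \<le> C"
        using free_holomorphic_bound[OF free_holomorphic_diff[OF hol hol]] r s by (metis less_trans)
      show ?thesis
      proof (rule cauchy_estimate[OF infinite_dim less_imp_le[OF r(1)] s(1) C])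
        fix X :: "'n \<Rightarrow> ('h \<Rightarrow>\<^sub>L 'h)" assume X: "X \<in> operator_ball r"
        have "eval_series (\<lambda>\<alpha>. F m \<alpha> - F p \<alpha>) X = eval_series (F m) X - eval_series (F p) X"
          using r by (intro eval_series_diff[OF hol hol X]) simp_all
        thus "norm (eval_series (\<lambda>\<alpha>. F m \<alpha> - F p \<alpha>) X) \<le> e"
          using N[OF mp X] by (simp add: dist_norm)
      qed
    qed
    thus ?thesis by blast
  qed
  obtain G where G: "G \<in> free_holomorphic" "coeff_converges F G"
    using coeff_cauchy_imp_converges[OF hol cauchy] by blast
  have "uniform_limit (operator_ball r :: ('n \<Rightarrow> ('h \<Rightarrow>\<^sub>L 'h)) set)
      (\<lambda>m X. eval_series (hausdorff_derivs is (F m)) X)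
      (\<lambda>X. eval_series (hausdorff_derivs is G) X) sequentially"
    if "0 \<le> r" "r < 1" for "is" r
    using that
    by (intro coeff_converges_imp_uniform_limit free_holomorphic_hausdorff_derivs
        coeff_converges_hausdorff_derivs hol G)
  moreover have "uniform_limit (operator_ball r :: ('n \<Rightarrow> ('h \<Rightarrow>\<^sub>L 'h)) set)
      (\<lambda>m X. eval_series (F m) X) (\<lambda>X. eval_series G X) sequentially" if "0 \<le> r" "r < 1" for r
    using that by (intro coeff_converges_imp_uniform_limit hol G)
  ultimately show ?thesis using G(1) by blast
qed

end
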